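(* Let $\alpha : \mathfrak{A} \to \mathfrak{B}$ be a normal de Vries extension. Then $\alpha$ is maximal.
   Context: A de Vries algebra is a pair $\mathfrak A=(A,\prec)$, where $A$ is a complete Boolean algebra and $\prec$ is a binary relation on $A$ with: (DV1) $1\prec 1$; (DV2) $a\prec b$ implies $a\le b$; (DV3) $a\le b\prec c\le d$ implies $a\prec d$; (DV4) $a\prec b,c$ implies $a\prec b\wedge c$; (DV5) $a\prec b$ implies $\neg b\prec\neg a$; (DV6) $a\prec b$ implies there is $c$ with $a\prec c\prec b$; (DV7) $b=\bigvee\{a\in A\mid a\prec b\}$. A de Vries morphism $\rho:\mathfrak A\to\mathfrak B$ is a map with: (M1) $\rho(0)=0$; (M2) $\rho(a\wedge b)=\rho(a)\wedge\rho(b)$; (M3) $a\prec b$ implies $\neg\rho(\neg a)\prec\rho(b)$; (M4) $\rho(b)=\bigvee\{\rho(a)\mid a\prec b\}$. The composition of de Vries morphisms $\rho_1:\mathfrak A_1\to\mathfrak A_2$ and $\rho_2:\mathfrak A_2\to\mathfrak A_3$ is $(\rho_2\star\rho_1)(b)=\bigvee\{\rho_2(\rho_1(a))\mid a\prec b\}$. A de Vries algebra is extremally disconnected if $a\prec b$ iff $a\le b$, and atomic if $A$ is an atomic Boolean algebra. A de Vries extension is a one-to-one de Vries morphism $\alpha:\mathfrak A\to\mathfrak B$ with $\mathfrak B$ atomic and extremally disconnected such that every element of $\mathfrak B$ is a join of meets of elements of $\alpha[\mathfrak A]$. A filter $F$ of $\mathfrak A$ is round if for each $b\in F$ there is $a\in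 F$ with $a\prec b$; an ideal $I$ is round if for each $a\in I$ there is $b\in I$ with $a\prec b$. A de Vries extension $\alpha:\mathfrak A\to\mathfrak B$ is normal if: whenever $F$ is a round filter and $I$ a round ideal of $\mathfrak A$ with $\bigwedge\alpha[F]\le\bigvee\alpha[I]$, there are $a,b\in\mathfrak A$ such that $a\prec b$, $\bigwedge\alpha[F]\le\alpha(a)$, and $\alpha(b)\le\bigvee\alpha[I]$. Two de Vries extensions $\alpha:\mathfrak A\to\mathfrak B$ and $\gamma:\mathfrak C\to\mathfrak B$ are compatible if $\alpha[\mathfrak A]=\gamma[\mathfrak C]$. A de Vries extension $\alpha:\mathfrak A\to\mathfrak B$ is maximal if for every compatible de Vries extension $\gamma:\mathfrak C\to\mathfrak B$ there is a de Vries morphism $\delta:\mathfrak C\to\mathfrak A$ with $\alpha\star\delta=\gamma$. *)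

theory Defs
  imports Main
begin

text \<open>
  The library class \<open>complete_boolean_algebra\<close> extends \<open>complete_distrib_lattice\<close>, that is, it demands
  complete distributivity, which forces the algebra to be atomic. De Vries algebras are based on
  arbitrary complete Boolean algebras, hence the following class, which adds no further axiom.
\<close>

class complete_ba = boolean_algebra + complete_lattice

locale de_vries_algebra =
  fixes prec :: "'a::complete_ba \<Rightarrow> 'a \<Rightarrow> bool"  (infix \<open>\<prec>\<close> 50)
  assumes DV1: "top \<prec> top"
    and DV2: "a \<prec> b \<Longrightarrow> a \<le> b"
    and DV3: "a \<le> b \<Longrightarrow> b \<prec> c \<Longrightarrow> c \<le> d \<Longrightarrow> a \<prec> d"
    and DV4: "a \<prec> b \<Longrightarrow> a \<prec> c \<Longrightarrow> a \<prec> inf b c"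
    and DV5: "a \<prec> b \<Longrightarrow> - b \<prec> - a"
    and DV6: "a \<prec> b \<Longrightarrow> \<exists>c. a \<prec> c \<and> c \<prec> b"
    and DV7: "b = Sup {a. a \<prec> b}"

locale de_vries_morphism =
  source: de_vries_algebra prec1 + target: de_vries_algebra prec2
  for prec1 :: "'a::complete_ba \<Rightarrow> 'a \<Rightarrow> bool"
    and prec2 :: "'b::complete_ba \<Rightarrow> 'b \<Rightarrow> bool" +
  fixes \<rho> :: "'a \<Rightarrow> 'b"
  assumes M1: "\<rho> bot = bot"
    and M2: "\<rho> (inf a b) = inf (\<rho> a) (\<rho> b)"
    and M3: "prec1 a b \<Longrightarrow> prec2 (- \<rho> (- a)) (\<rho> b)"
    and M4: "\<rho> b = Sup {\<rho> a | a. prec1 a b}"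

text \<open>
  In \<open>dv_comp prec1 \<rho>2 \<rho>1\<close>, the composition \<open>\<rho>2 \<star> \<rho>1\<close>, the relation \<open>prec1\<close> is that of the source of \<open>\<rho>1\<close>.
\<close>

definition dv_comp ::
  "('a::complete_ba \<Rightarrow> 'a \<Rightarrow> bool) \<Rightarrow> ('b::complete_ba \<Rightarrow> 'c::complete_ba) \<Rightarrow> ('a \<Rightarrow> 'b) \<Rightarrow> 'a \<Rightarrow> 'c"
  where "dv_comp prec1 \<rho>2 \<rho>1 = (\<lambda>b. Sup {\<rho>2 (\<rho>1 a) | a. prec1 a b})"

definition extremally_disconnected :: "('a::complete_ba \<Rightarrow> 'a \<Rightarrow> bool) \<Rightarrow> bool"
  where "extremally_disconnected prec \<longleftrightarrow> (\<forall>a b. prec a b \<longleftrightarrow> a \<le> b)"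

definition is_atom :: "'a::complete_ba \<Rightarrow> bool"
  where "is_atom x \<longleftrightarrow> x \<noteq> bot \<and> (\<forall>y. y \<le> x \<longrightarrow> y = bot \<or> y = x)"

text \<open>Atomicity is a property of the underlying algebra only, so the relation argument supplies just the type.\<close>

definition atomic :: "('a::complete_ba \<Rightarrow> 'a \<Rightarrow> bool) \<Rightarrow> bool"
  where "atomic prec \<longleftrightarrow> (\<forall>b::'a. b \<noteq> bot \<longrightarrow> (\<exists>x. is_atom x \<and> x \<le> b))"

locale de_vries_extension = de_vries_morphism precA precB \<alpha>
  for precA :: "'a::complete_ba \<Rightarrow> 'a \<Rightarrow> bool"
    and precB :: "'b::complete_ba \<Rightarrow> 'b \<Rightarrow> bool"
    and \<alpha> :: "'a \<Rightarrow> 'b" +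
  assumes one_to_one: "inj \<alpha>"
    and target_atomic: "atomic precB"
    and target_extremally_disconnected: "extremally_disconnected precB"
    and join_of_meets: "\<exists>\<S>. (\<forall>S\<in>\<S>. S \<subseteq> range \<alpha>) \<and> b = Sup (Inf ` \<S>)"

text \<open>Filters and ideals are nonempty; they need not be proper.\<close>

definition ba_filter :: "'a::complete_ba set \<Rightarrow> bool"
  where "ba_filter F \<longleftrightarrow> F \<noteq> {} \<and> (\<forall>a\<in>F. \<forall>b. a \<le> b \<longrightarrow> b \<in> F) \<and> (\<forall>a\<in>F. \<forall>b\<in>F. inf a b \<in> F)"

definition ba_ideal :: "'a::complete_ba set \<Rightarrow> bool"
  where "ba_ideal I \<longleftrightarrow> I \<noteq> {} \<and> (\<forall>a\<in>I. \<forall>b. b \<le> a \<longrightarrow> b \<in> I) \<and> (\<forall>a\<in>I. \<forall>b\<in>I. sup a b \<in> I)"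

definition round_filter :: "('a::complete_ba \<Rightarrow> 'a \<Rightarrow> bool) \<Rightarrow> 'a set \<Rightarrow> bool"
  where "round_filter prec F \<longleftrightarrow> ba_filter F \<and> (\<forall>b\<in>F. \<exists>a\<in>F. prec a b)"

definition round_ideal :: "('a::complete_ba \<Rightarrow> 'a \<Rightarrow> bool) \<Rightarrow> 'a set \<Rightarrow> bool"
  where "round_ideal prec I \<longleftrightarrow> ba_ideal I \<and> (\<forall>a\<in>I. \<exists>b\<in>I. prec a b)"

locale normal_de_vries_extension = de_vries_extension precA precB \<alpha>
  for precA :: "'a::complete_ba \<Rightarrow> 'a \<Rightarrow> bool"
    and precB :: "'b::complete_ba \<Rightarrow> 'b \<Rightarrow> bool"
    and \<alpha> :: "'a \<Rightarrow> 'b" +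
  assumes normal: "round_filter precA F \<Longrightarrow> round_ideal precA I \<Longrightarrow> Inf (\<alpha> ` F) \<le> Sup (\<alpha> ` I) \<Longrightarrow>
    \<exists>a b. precA a b \<and> Inf (\<alpha> ` F) \<le> \<alpha> a \<and> \<alpha> b \<le> Sup (\<alpha> ` I)"

definition compatible :: "('a::complete_ba \<Rightarrow> 'b::complete_ba) \<Rightarrow> ('c::complete_ba \<Rightarrow> 'b) \<Rightarrow> bool"
  where "compatible \<alpha> \<gamma> \<longleftrightarrow> range \<alpha> = range \<gamma>"

text \<open>
  HOL formulas cannot quantify over types, so the type \<open>'c\<close> carrying the algebras that compete with the
  source of \<open>\<alpha>\<close> is a parameter. Maximality is obtained by stating the property for a type variable \<open>'c\<close>
  that is unrelated to the types of \<open>\<alpha>\<close>.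
\<close>

definition maximal_de_vries_extension ::
  "'c::complete_ba itself \<Rightarrow> ('a::complete_ba \<Rightarrow> 'a \<Rightarrow> bool) \<Rightarrow> ('b::complete_ba \<Rightarrow> 'b \<Rightarrow> bool) \<Rightarrow>
    ('a \<Rightarrow> 'b) \<Rightarrow> bool"
  where "maximal_de_vries_extension TYPE('c) precA precB \<alpha> \<longleftrightarrow>
    de_vries_extension precA precB \<alpha> \<and>
    (\<forall>(precC :: 'c \<Rightarrow> 'c \<Rightarrow> bool) \<gamma>.
      de_vries_extension precC precB \<gamma> \<and> compatible \<alpha> \<gamma> \<longrightarrow>
      (\<exists>\<delta>. de_vries_morphism precC precA \<delta> \<and> dv_comp precC \<alpha> \<delta> = \<gamma>))"

end

theory Submission
  imports Defs
begin

text \<open>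
  A one-to-one de Vries morphism is an order embedding, so when \<open>\<alpha>\<close> and \<open>\<gamma>\<close> have the same image, the
  two sources are isomorphic as Boolean algebras, by a unique map \<open>\<delta>\<close> with \<open>\<alpha> \<circ> \<delta> = \<gamma>\<close>. Only the
  proximity relations may differ, and what has to be shown is that \<open>\<delta>\<close> carries proximity in the
  source of \<open>\<gamma>\<close> to proximity in the source of \<open>\<alpha>\<close>.

  Topologically, the elements of the image of \<open>\<alpha>\<close> are basic regular open sets of a space, and
  \<open>- \<alpha> (- c)\<close> is the closure of \<open>\<alpha> c\<close>. Proximity of \<open>c\<close> to \<open>d\<close> with respect to \<open>\<gamma>\<close> puts the closure of
  \<open>\<gamma> c\<close> inside \<open>\<gamma> d\<close>, a statement about the common image alone. Normality of \<open>\<alpha>\<close> converts such an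
  inclusion back into proximity (\<open>prec_iff_closure_le\<close>): the closure of \<open>\<alpha> c\<close> is the meet of \<open>\<alpha>\<close> over
  the round filter of elements above \<open>c\<close> in the proximity, \<open>\<alpha> d\<close> is the join of \<open>\<alpha>\<close> over the round
  ideal of elements below \<open>d\<close>, and the pair supplied by normality interpolates between \<open>c\<close> and \<open>d\<close>.
  Thus the relation of a normal extension is the largest one that its image admits.
\<close>

lemma (in de_vries_algebra) bot_prec: "bot \<prec> a"
  using DV3[of bot bot bot a] DV5[OF DV1] by simp

lemma (in de_vries_algebra) prec_top: "a \<prec> top"
  using DV3[of a top top top] DV1 by simp

lemma (in de_vries_algebra) sup_prec:
  assumes "a \<prec> c" "b \<prec> c"
  shows "sup a b \<prec> c"
  using DV5[OF DV4[OF DV5[OF assms(1)] DV5[OF assms(2)]]] by simp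

lemma (in de_vries_algebra) round_ideal_below: "round_ideal (\<prec>) {x. x \<prec> d}"
proof -
  have "b \<prec> d" if "a \<prec> d" "b \<le> a" for a b
    using DV3[OF that(2,1)] by simp
  then have "ba_ideal {x. x \<prec> d}"
    using bot_prec sup_prec by (auto simp: ba_ideal_def)
  then show ?thesis
    using DV6 by (auto simp: round_ideal_def)
qed

lemma (in de_vries_algebra) round_filter_above: "round_filter (\<prec>) {x. c \<prec> x}"
proof -
  have "c \<prec> b" if "c \<prec> a" "a \<le> b" for a b
    using DV3[OF order_refl that] .
  then have "ba_filter {x. c \<prec> x}"
    using prec_top DV4 by (auto simp: ba_filter_def)
  then show ?thesis
    using DV6 by (auto simp: round_filter_def)
qed

lemma (in de_vries_morphism) morphism_le_closure: "\<rho> a \<le> - \<rho> (- a)"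
proof -
  have "inf (\<rho> a) (\<rho> (- a)) = bot"
    using M2[of a "- a"] M1 by simp
  then show ?thesis
    by (simp add: inf_shunt)
qed

text \<open>
  By duality, (M4) for \<open>- c\<close> writes the closure \<open>- \<rho> (- c)\<close> as the meet of the closures \<open>- \<rho> (- x)\<close> over
  all \<open>x\<close> to which \<open>c\<close> is proximal. Replacing each closure by the smaller \<open>\<rho> x\<close> can only lower the meet.
\<close>

lemma (in de_vries_morphism) Inf_above_le_closure:
  "Inf (\<rho> ` {x. prec1 c x}) \<le> - \<rho> (- c)"
proof -
  have "\<rho> (- c) \<le> - Inf (\<rho> ` {x. prec1 c x})"
  proof (subst M4, rule Sup_least, clarify)
    fix y assume "prec1 y (- c)"
    then have "prec1 c (- y)"
      using source.DV5 by fastforce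
    then have "Inf (\<rho> ` {x. prec1 c x}) \<le> \<rho> (- y)"
      by (auto intro: Inf_lower)
    also have "\<dots> \<le> - \<rho> y"
      using morphism_le_closure[of "- y"] by simp
    finally show "\<rho> y \<le> - Inf (\<rho> ` {x. prec1 c x})"
      by (metis compl_le_swap1)
  qed
  then show ?thesis
    by (metis compl_le_swap1)
qed

lemma (in de_vries_extension) target_prec_iff: "precB x y \<longleftrightarrow> x \<le> y"
  using target_extremally_disconnected by (simp add: extremally_disconnected_def)

lemma (in de_vries_extension) extension_le_iff: "\<alpha> a \<le> \<alpha> b \<longleftrightarrow> a \<le> b"
  using M2[of a b] one_to_one by (metis inj_eq le_iff_inf)

lemma (in normal_de_vries_extension) prec_iff_closure_le:
  "precA c d \<longleftrightarrow> - \<alpha> (- c) \<le> \<alpha> d"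
proof
  assume "precA c d"
  then show "- \<alpha> (- c) \<le> \<alpha> d"
    using M3 target_prec_iff by blast
next
  assume closure_le: "- \<alpha> (- c) \<le> \<alpha> d"
  let ?F = "{x. precA c x}" and ?I = "{x. precA x d}"
  have I: "Sup (\<alpha> ` ?I) = \<alpha> d"
    by (simp add: M4[of d] setcompr_eq_image)
  have "Inf (\<alpha> ` ?F) \<le> Sup (\<alpha> ` ?I)"
    using Inf_above_le_closure closure_le unfolding I by (rule order_trans)
  then obtain a b where ab: "precA a b"
    and a: "Inf (\<alpha> ` ?F) \<le> \<alpha> a" and b: "\<alpha> b \<le> Sup (\<alpha> ` ?I)"
    using normal source.round_filter_above source.round_ideal_below by metis
  have "\<alpha> c \<le> Inf (\<alpha> ` ?F)"
    by (auto intro!: Inf_greatest simp: extension_le_iff dest: source.DV2)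
  then have "c \<le> a"
    using a extension_le_iff order_trans by blast
  moreover have "b \<le> d"
    using b by (simp add: I extension_le_iff)
  ultimately show "precA c d"
    using ab source.DV3 by blast
qed

lemma order_iso_compl:
  fixes f :: "'a::boolean_algebra \<Rightarrow> 'b::boolean_algebra"
  assumes iff: "\<And>x y. f x \<le> f y \<longleftrightarrow> x \<le> y" and "surj f"
  shows "f (- x) = - f x"
proof -
  obtain y where y: "- f x = f y"
    using \<open>surj f\<close> by (metis surjD)
  obtain l u where l: "f l = bot" and u: "f u = top"
    using \<open>surj f\<close> by (metis surjD)
  have "l = bot" "u = top"
    using iff[of l bot] iff[of top u] l u by (simp_all add: bot_unique top_unique)
  have "inf x y \<le> l"
  proof -
    have "f (inf x y) \<le> inf (f x) (f y)"
      using iff by simp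
    then show ?thesis
      using iff[of "inf x y" l] by (simp add: l flip: y)
  qed
  moreover have "u \<le> sup x y"
  proof -
    have "sup (f x) (f y) \<le> f (sup x y)"
      using iff by simp
    then show ?thesis
      using iff[of u "sup x y"] by (simp add: u flip: y)
  qed
  ultimately have "- x = y"
    using \<open>l = bot\<close> \<open>u = top\<close> by (intro compl_unique) (simp_all add: bot_unique top_unique)
  then show ?thesis
    using y by simp
qed

lemma order_iso_Sup:
  fixes f :: "'a::complete_lattice \<Rightarrow> 'b::complete_lattice"
  assumes iff: "\<And>x y. f x \<le> f y \<longleftrightarrow> x \<le> y" and "surj f"
  shows "f (Sup X) = Sup (f ` X)"
proof (rule antisym)
  obtain y where y: "Sup (f ` X) = f y"
    using \<open>surj f\<close> by (metis surjD)
  have "x \<le> y" if "x \<in> X" for x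
    using that iff[of x y] by (auto simp flip: y intro: Sup_upper)
  then show "f (Sup X) \<le> Sup (f ` X)"
    using iff by (auto simp: y intro: Sup_least)
  show "Sup (f ` X) \<le> f (Sup X)"
    using iff by (auto intro!: Sup_least Sup_upper)
qed

text \<open>
  An order isomorphism that preserves proximity is a de Vries morphism: (M3) loses its complements,
  and (M4) is the image of (DV7).
\<close>

lemma order_iso_de_vries_morphism:
  assumes "de_vries_algebra prec1" "de_vries_algebra prec2"
    and iff: "\<And>x y. f x \<le> f y \<longleftrightarrow> x \<le> y" and "surj f"
    and prec: "\<And>x y. prec1 x y \<Longrightarrow> prec2 (f x) (f y)"
  shows "de_vries_morphism prec1 prec2 f"
proof -
  interpret source: de_vries_algebra prec1 by fact
  interpret target: de_vries_algebra prec2 by fact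
  have compl: "f (- x) = - f x" for x
    using iff \<open>surj f\<close> by (rule order_iso_compl)
  have Sup: "f (Sup X) = Sup (f ` X)" for X
    using iff \<open>surj f\<close> by (rule order_iso_Sup)
  have sup: "f (sup x y) = sup (f x) (f y)" for x y
    using Sup[of "{x, y}"] by simp
  show ?thesis
  proof
    show "f bot = bot"
      using Sup[of "{}"] by simp
    show "f (inf a b) = inf (f a) (f b)" for a b
      using compl[of "sup (- a) (- b)"] by (simp add: sup compl)
    show "prec2 (- f (- a)) (f b)" if "prec1 a b" for a b
      using prec[OF that] by (simp add: compl)
    show "f b = Sup {f a | a. prec1 a b}" for b
      using Sup[of "{a. prec1 a b}"] by (simp add: setcompr_eq_image flip: source.DV7)
  qed
qed

theorem corollary3p3:
  fixes precA :: "'a::complete_ba \<Rightarrow> 'a \<Rightarrow> bool"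
    and precB :: "'b::complete_ba \<Rightarrow> 'b \<Rightarrow> bool"
    and \<alpha> :: "'a \<Rightarrow> 'b"
  assumes "normal_de_vries_extension precA precB \<alpha>"
  shows "maximal_de_vries_extension TYPE('c::complete_ba) precA precB \<alpha>"
  unfolding maximal_de_vries_extension_def
proof (intro conjI allI impI; (elim conjE)?)
  interpret normal_de_vries_extension precA precB \<alpha> by fact
  show "de_vries_extension precA precB \<alpha>"
    by unfold_locales
  fix precC :: "'c \<Rightarrow> 'c \<Rightarrow> bool" and \<gamma> :: "'c \<Rightarrow> 'b"
  assume \<gamma>: "de_vries_extension precC precB \<gamma>" and compat: "compatible \<alpha> \<gamma>"
  interpret \<gamma>: de_vries_extension precC precB \<gamma> by fact
  have range_eq: "range \<alpha> = range \<gamma>"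
    using compat by (simp add: compatible_def)
  define \<delta> where "\<delta> = inv \<alpha> \<circ> \<gamma>"
  have \<alpha>\<delta>: "\<alpha> (\<delta> c) = \<gamma> c" for c
    using range_eq by (simp add: \<delta>_def f_inv_into_f)
  have le_iff: "\<delta> x \<le> \<delta> y \<longleftrightarrow> x \<le> y" for x y
    by (metis \<alpha>\<delta> extension_le_iff \<gamma>.extension_le_iff)
  have "\<exists>c. a = \<delta> c" for a
  proof -
    obtain c where "\<alpha> a = \<gamma> c"
      using range_eq by blast
    then have "a = \<delta> c"
      using one_to_one \<alpha>\<delta> by (metis injD)
    then show ?thesis ..
  qed
  then have surj: "surj \<delta>"
    by (simp add: surj_def)
  have compl: "\<delta> (- x) = - \<delta> x" for x
    using le_iff surj by (rule order_iso_compl)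
  have "precA (\<delta> c) (\<delta> d)" if "precC c d" for c d
  proof -
    have "- \<gamma> (- c) \<le> \<gamma> d"
      using \<gamma>.M3[OF that] by (simp add: \<gamma>.target_prec_iff)
    then show ?thesis
      by (simp add: prec_iff_closure_le \<alpha>\<delta> flip: compl)
  qed
  then have "de_vries_morphism precC precA \<delta>"
    by (intro order_iso_de_vries_morphism le_iff surj)
      (use source.de_vries_algebra_axioms \<gamma>.source.de_vries_algebra_axioms in auto)
  moreover have "dv_comp precC \<alpha> \<delta> = \<gamma>"
    by (simp add: dv_comp_def \<alpha>\<delta> fun_eq_iff flip: \<gamma>.M4)
  ultimately show "\<exists>\<delta>. de_vries_morphism precC precA \<delta> \<and> dv_comp precC \<alpha> \<delta> = \<gamma>"
    by blast
qed

end
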